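(* Let $X$ be a nontrivial complex Banach space and let $A(B_X)$ denote either $A_u(B_X)$ or $A_b(B_X)$. Then the norm $\|\cdot\|$ of $A(B_X)$ is nowhere Fréchet differentiable, i.e. it is not Fréchet differentiable at any $f\in A(B_X)$.
   Context: $B_X$ is the closed unit ball of $X$. $A_b(B_X)$ is the Banach space (sup norm) of bounded continuous functions $B_X\to\mathbb{C}$ that are analytic (holomorphic) on the interior of $B_X$; $A_u(B_X)$ is its subspace of functions uniformly continuous on $B_X$. The norm of a Banach space $Z$ is Fréchet differentiable at $z$ if $\lim_{t\to0}\frac{\|z+ty\|+\|z-ty\|-2\|z\|}{t}=0$ ($t$ real) uniformly for $y$ in the unit sphere $S_Z$. *)

theory Defs
  imports "HOL-Analysis.Analysis"
begin

text \<open>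
  HOL-Analysis only has real Banach spaces. A complex one is a real one with a compatible complex
  scalar multiplication, for which the norm is absolutely homogeneous.
\<close>

class complex_normed_vector = real_normed_vector +
  fixes scaleC :: "complex \<Rightarrow> 'a \<Rightarrow> 'a" (infixr "*\<^sub>C" 75)
  assumes scaleC_add_right: "c *\<^sub>C (x + y) = c *\<^sub>C x + c *\<^sub>C y"
    and scaleC_add_left: "(c + d) *\<^sub>C x = c *\<^sub>C x + d *\<^sub>C x"
    and scaleC_scaleC: "c *\<^sub>C d *\<^sub>C x = (c * d) *\<^sub>C x"
    and scaleC_of_real: "complex_of_real r *\<^sub>C x = r *\<^sub>R x"
    and norm_scaleC: "norm (c *\<^sub>C x) = cmod c * norm x"

class complex_banach = complex_normed_vector + banach

instantiation complex :: complex_banach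
begin
definition scaleC_complex :: "complex \<Rightarrow> complex \<Rightarrow> complex"
  where "scaleC_complex c x = c * x"
instance
  by standard
    (simp_all add: scaleC_complex_def algebra_simps norm_mult scaleR_conv_of_real)
end

text \<open>
  The closed unit ball as a metric space of its own, so that bounded continuous functions on it,
  with their sup norm, are the library's \<open>bcontfun\<close>.
\<close>

typedef (overloaded) 'a unit_ball = "cball (0 :: 'a :: real_normed_vector) 1"
  morphisms of_unit_ball to_unit_ball
  by (rule exI[of _ 0]) simp

instantiation unit_ball :: (real_normed_vector) metric_space
begin
definition dist_unit_ball :: "'a unit_ball \<Rightarrow> 'a unit_ball \<Rightarrow> real"
  where "dist_unit_ball x y = dist (of_unit_ball x) (of_unit_ball y)"
definition uniformity_unit_ball :: "('a unit_ball \<times> 'a unit_ball) filter"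
  where "uniformity_unit_ball = (INF e\<in>{0 <..}. principal {(x, y). dist x y < e})"
definition open_unit_ball :: "'a unit_ball set \<Rightarrow> bool"
  where "open_unit_ball S \<longleftrightarrow> (\<forall>x\<in>S. \<forall>\<^sub>F (x', y) in uniformity. x' = x \<longrightarrow> y \<in> S)"
instance
proof
  fix x y z :: "'a unit_ball"
  show "dist x y = 0 \<longleftrightarrow> x = y"
    by (simp add: dist_unit_ball_def of_unit_ball_inject)
  show "dist x y \<le> dist x z + dist y z"
    by (simp add: dist_unit_ball_def dist_triangle2)
qed (simp_all add: uniformity_unit_ball_def open_unit_ball_def)
end

definition holomorphic_on_open :: "('a :: complex_normed_vector \<Rightarrow> complex) \<Rightarrow> 'a set \<Rightarrow> bool"
  where "holomorphic_on_open g U \<longleftrightarrow>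
    open U \<and> (\<forall>x\<in>U. \<exists>D. (g has_derivative D) (at x) \<and> (\<forall>c v. D (c *\<^sub>C v) = c * D v))"

text \<open>
  Outside the closed ball the values of \<open>to_unit_ball\<close> are unspecified; they do not matter, since
  differentiability at an interior point is local.
\<close>

definition A_b :: "('a :: complex_banach unit_ball \<Rightarrow>\<^sub>C complex) set"
  where "A_b = {f. holomorphic_on_open (\<lambda>x. apply_bcontfun f (to_unit_ball x))
                     (interior (cball 0 1))}"

definition A_u :: "('a :: complex_banach unit_ball \<Rightarrow>\<^sub>C complex) set"
  where "A_u = {f \<in> A_b. uniformly_continuous_on UNIV (apply_bcontfun f)}"

text \<open>\<open>Z\<close> is a subspace of an ambient normed space and carries the restricted norm.\<close>

definition norm_frechet_differentiable_at :: "'z :: real_normed_vector set \<Rightarrow> 'z \<Rightarrow> bool"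
  where "norm_frechet_differentiable_at Z z \<longleftrightarrow>
    uniform_limit {y \<in> Z. norm y = 1}
      (\<lambda>t y. (norm (z + t *\<^sub>R y) + norm (z - t *\<^sub>R y) - 2 * norm z) / t) (\<lambda>_. 0)
      (at (0 :: real))"

lemma subspace_A_b: "subspace (A_b :: ('a :: complex_banach unit_ball \<Rightarrow>\<^sub>C complex) set)"
proof (rule subspaceI)
  show "0 \<in> (A_b :: ('a unit_ball \<Rightarrow>\<^sub>C complex) set)"
    by (auto simp: A_b_def holomorphic_on_open_def intro!: exI[of _ "\<lambda>_. 0"])
next
  fix f g :: "'a unit_ball \<Rightarrow>\<^sub>C complex"
  assume f: "f \<in> A_b" and g: "g \<in> A_b"
  show "f + g \<in> A_b"
    unfolding A_b_def holomorphic_on_open_def mem_Collect_eq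
  proof (intro conjI ballI)
    fix x :: 'a assume x: "x \<in> interior (cball 0 1)"
    obtain D where D: "((\<lambda>x. apply_bcontfun f (to_unit_ball x)) has_derivative D) (at x)"
      "\<And>c v. D (c *\<^sub>C v) = c * D v"
      using f x by (auto simp: A_b_def holomorphic_on_open_def)
    obtain E where E: "((\<lambda>x. apply_bcontfun g (to_unit_ball x)) has_derivative E) (at x)"
      "\<And>c v. E (c *\<^sub>C v) = c * E v"
      using g x by (auto simp: A_b_def holomorphic_on_open_def)
    show "\<exists>D. ((\<lambda>x. apply_bcontfun (f + g) (to_unit_ball x)) has_derivative D) (at x) \<and>
        (\<forall>c v. D (c *\<^sub>C v) = c * D v)"
      using has_derivative_add[OF D(1) E(1)] D(2) E(2)
      by (intro exI[of _ "\<lambda>v. D v + E v"]) (simp add: distrib_left)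
  qed simp
next
  fix r :: real and f :: "'a unit_ball \<Rightarrow>\<^sub>C complex"
  assume f: "f \<in> A_b"
  show "r *\<^sub>R f \<in> A_b"
    unfolding A_b_def holomorphic_on_open_def mem_Collect_eq
  proof (intro conjI ballI)
    fix x :: 'a assume x: "x \<in> interior (cball 0 1)"
    obtain D where D: "((\<lambda>x. apply_bcontfun f (to_unit_ball x)) has_derivative D) (at x)"
      "\<And>c v. D (c *\<^sub>C v) = c * D v"
      using f x by (auto simp: A_b_def holomorphic_on_open_def)
    show "\<exists>D. ((\<lambda>x. apply_bcontfun (r *\<^sub>R f) (to_unit_ball x)) has_derivative D) (at x) \<and>
        (\<forall>c v. D (c *\<^sub>C v) = c * D v)"
      using has_derivative_scaleR_right[OF D(1), of r] D(2)
      by (intro exI[of _ "\<lambda>v. r *\<^sub>R D v"]) simp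
  qed simp
qed

lemma subspace_A_u: "subspace (A_u :: ('a :: complex_banach unit_ball \<Rightarrow>\<^sub>C complex) set)"
proof (rule subspaceI)
  show "0 \<in> (A_u :: ('a unit_ball \<Rightarrow>\<^sub>C complex) set)"
    using subspace_0[OF subspace_A_b] by (simp add: A_u_def uniformly_continuous_on_const)
next
  fix f g :: "'a unit_ball \<Rightarrow>\<^sub>C complex"
  assume fg: "f \<in> A_u" "g \<in> A_u"
  have "uniformly_continuous_on UNIV (\<lambda>x. apply_bcontfun f x + apply_bcontfun g x)"
    using fg by (intro uniformly_continuous_on_add) (auto simp: A_u_def)
  then show "f + g \<in> A_u"
    using fg subspace_add[OF subspace_A_b, of f g] by (simp add: A_u_def plus_bcontfun.rep_eq)
next
  fix r :: real and f :: "'a unit_ball \<Rightarrow>\<^sub>C complex"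
  assume f: "f \<in> A_u"
  have "uniformly_continuous_on UNIV (\<lambda>x. r *\<^sub>R apply_bcontfun f x)"
    using f by (intro uniformly_continuous_on_cmul) (auto simp: A_u_def)
  then show "r *\<^sub>R f \<in> A_u"
    using f subspace_scale[OF subspace_A_b, of f r] by (simp add: A_u_def scaleR_bcontfun.rep_eq)
qed

end

theory Submission
  imports Defs "HOL-Complex_Analysis.Complex_Analysis"
begin

text \<open>
  Let \<open>x\<close> be a point of the open ball at which \<open>\<bar>f x\<bar>\<close> almost attains \<open>\<parallel>f\<parallel>\<close>, and \<open>x = r u\<close> with
  \<open>\<parallel>u\<parallel> = 1\<close>. By the maximum modulus principle on the disc spanned by \<open>u\<close>, there is a \<open>y\<close> at
  pseudohyperbolic distance \<open>1/2\<close> from \<open>x\<close> with \<open>\<bar>f y\<bar> \<ge> \<bar>f x\<bar>\<close>. Composing a norming functional of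
  \<open>u\<close> with a disc automorphism gives a \<open>g\<close> in \<open>A\<^sub>u\<close> of norm 1 with \<open>g x = 0\<close>, \<open>\<bar>g y\<bar> = 1/2\<close> and the
  phase of \<open>f y\<close> at \<open>y\<close>. Evaluating \<open>f + t g\<close> at \<open>y\<close> and \<open>f - t g\<close> at \<open>x\<close> shows that
  \<open>\<parallel>f + t g\<parallel> + \<parallel>f - t g\<parallel> - 2 \<parallel>f\<parallel>\<close> is at least about \<open>t/2\<close>, however small \<open>t > 0\<close> is.
\<close>

section \<open>Norming functionals\<close>

definition sublinear :: "('a::real_vector \<Rightarrow> real) \<Rightarrow> bool"
  where "sublinear p \<longleftrightarrow>
    (\<forall>x y. p (x + y) \<le> p x + p y) \<and> (\<forall>r x. 0 \<le> r \<longrightarrow> p (r *\<^sub>R x) \<le> r * p x)"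

lemma sublinear_add: "sublinear p \<Longrightarrow> p (x + y) \<le> p x + p y"
  and sublinear_scaleR_le: "sublinear p \<Longrightarrow> 0 \<le> r \<Longrightarrow> p (r *\<^sub>R x) \<le> r * p x"
  by (auto simp: sublinear_def)

lemma sublinear_0:
  assumes "sublinear p"
  shows "p 0 = 0"
  using sublinear_add[OF assms, of 0 0] sublinear_scaleR_le[OF assms, of 0 0] by simp

text \<open>Applying the homogeneity inequality with factor \<open>1 / r\<close> to the scaled
  vector gives the reverse inequality.\<close>

lemma sublinear_scaleR:
  assumes p: "sublinear p" and "0 \<le> r"
  shows "p (r *\<^sub>R x) = r * p x"
proof (cases "r = 0")
  case False
  then have "p x \<le> p (r *\<^sub>R x) / r"
    using sublinear_scaleR_le[OF p, of "1 / r" "r *\<^sub>R x"] \<open>0 \<le> r\<close> by simp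
  then have "r * p x \<le> p (r *\<^sub>R x)"
    using False \<open>0 \<le> r\<close> by (simp add: field_simps)
  then show ?thesis
    using sublinear_scaleR_le[OF p \<open>0 \<le> r\<close>, of x] by simp
qed (simp add: sublinear_0[OF p])

lemma sublinear_minus_le:
  assumes "sublinear p"
  shows "- p (- x) \<le> p x"
  using sublinear_add[OF assms, of x "- x"] sublinear_0[OF assms] by simp

lemma sublinear_norm: "sublinear norm"
  by (simp add: sublinear_def norm_triangle_ineq)

text \<open>For sublinear \<open>p\<close> this is the largest sublinear functional below
  \<open>p\<close> whose value at \<open>- y\<close> is at most \<open>- p y\<close>.\<close>

definition sublinear_shift :: "('a::real_vector \<Rightarrow> real) \<Rightarrow> 'a \<Rightarrow> 'a \<Rightarrow> real"
  where "sublinear_shift p y x = (INF t\<in>{0..}. p (x + t *\<^sub>R y) - t * p y)"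

lemma sublinear_shift_le:
  assumes p: "sublinear p" and "0 \<le> t"
  shows "sublinear_shift p y x \<le> p (x + t *\<^sub>R y) - t * p y"
proof -
  \<comment> \<open>A bound independent of \<open>s\<close>, so the infimum is a genuine
    one.\<close>
  have "- p (- x) \<le> p (x + s *\<^sub>R y) - s * p y" if "0 \<le> s" for s
    using sublinear_add[OF p, of "x + s *\<^sub>R y" "- x"] sublinear_scaleR[OF p that, of y] by simp
  then have "bdd_below ((\<lambda>s. p (x + s *\<^sub>R y) - s * p y) ` {0..})"
    by (intro bdd_belowI2) auto
  then show ?thesis
    unfolding sublinear_shift_def using \<open>0 \<le> t\<close> by (intro cINF_lower) auto
qed

lemma sublinear_shift_greatest:
  assumes "\<And>t. 0 \<le> t \<Longrightarrow> m \<le> p (x + t *\<^sub>R y) - t * p y"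
  shows "m \<le> sublinear_shift p y x"
  unfolding sublinear_shift_def using assms by (intro cINF_greatest) auto

lemma sublinear_sublinear_shift:
  assumes p: "sublinear p"
  shows "sublinear (sublinear_shift p y)"
  unfolding sublinear_def
proof (intro conjI allI impI)
  fix x x' :: 'a
  let ?q = "sublinear_shift p y"
  \<comment> \<open>The parameters \<open>s\<close> and \<open>t\<close> of the two summands add up
    to an admissible parameter for \<open>x + x'\<close>; the infima over \<open>s\<close> and
    \<open>t\<close> are then taken one after the other.\<close>
  have le: "?q (x + x') \<le> (p (x + s *\<^sub>R y) - s * p y) + (p (x' + t *\<^sub>R y) - t * p y)"
    if "0 \<le> s" "0 \<le> t" for s t
    using sublinear_shift_le[OF p, of "s + t" y "x + x'"] that
      sublinear_add[OF p, of "x + s *\<^sub>R y" "x' + t *\<^sub>R y"]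
    by (simp add: algebra_simps)
  have "?q (x + x') - (p (x + s *\<^sub>R y) - s * p y) \<le> ?q x'" if "0 \<le> s" for s
    using le[OF that] by (intro sublinear_shift_greatest) (simp only: diff_le_eq add.commute)
  then have "?q (x + x') - ?q x' \<le> ?q x"
    by (intro sublinear_shift_greatest) (simp only: diff_le_eq add.commute)
  then show "?q (x + x') \<le> ?q x + ?q x'"
    by simp
next
  fix r :: real and x :: 'a
  let ?q = "sublinear_shift p y"
  assume "0 \<le> r"
  show "?q (r *\<^sub>R x) \<le> r * ?q x"
  proof (cases "r = 0")
    case True
    then show ?thesis
      using sublinear_shift_le[OF p, of 0 y 0] sublinear_0[OF p] by simp
  next
    case False
    with \<open>0 \<le> r\<close> have "0 < r" by simp
    have "?q (r *\<^sub>R x) / r \<le> p (x + t *\<^sub>R y) - t * p y" if "0 \<le> t" for t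
    proof -
      have "?q (r *\<^sub>R x) \<le> p (r *\<^sub>R x + (r * t) *\<^sub>R y) - r * t * p y"
        using \<open>0 < r\<close> that by (intro sublinear_shift_le[OF p]) simp
      also have "r *\<^sub>R x + (r * t) *\<^sub>R y = r *\<^sub>R (x + t *\<^sub>R y)"
        by (simp add: scaleR_add_right)
      finally have "?q (r *\<^sub>R x) \<le> r * (p (x + t *\<^sub>R y) - t * p y)"
        by (simp add: sublinear_scaleR[OF p \<open>0 \<le> r\<close>] right_diff_distrib)
      then show ?thesis
        using \<open>0 < r\<close> by (simp add: pos_divide_le_eq mult.commute)
    qed
    then have "?q (r *\<^sub>R x) / r \<le> ?q x"
      by (rule sublinear_shift_greatest)
    then show ?thesis
      using \<open>0 < r\<close> by (simp add: pos_divide_le_eq mult.commute)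
  qed
qed

text \<open>A minimal sublinear functional \<open>q\<close> equals its own shifts, and \<open>sublinear_shift q y x \<le> q (x + y) - q y\<close>.\<close>

lemma minimal_sublinear_is_linear:
  assumes q: "sublinear q" and minimal: "\<And>q'. sublinear q' \<Longrightarrow> q' \<le> q \<Longrightarrow> q' = q"
  shows "linear q"
proof -
  have add: "q (x + y) = q x + q y" for x y
  proof -
    have "sublinear_shift q y = q"
      using sublinear_shift_le[OF q, of 0 y]
      by (intro minimal sublinear_sublinear_shift[OF q]) (simp add: le_fun_def)
    then show ?thesis
      using sublinear_shift_le[OF q, of 1 y x] sublinear_add[OF q, of x y] by simp
  qed
  have minus: "q (- x) = - q x" for x
    using add[of x "- x"] sublinear_0[OF q] by simp
  have "q (r *\<^sub>R x) = r * q x" for r x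
  proof (cases "0 \<le> r")
    case False
    then show ?thesis
      using sublinear_scaleR[OF q, of "- r" x] minus[of "r *\<^sub>R x"] by simp
  qed (rule sublinear_scaleR[OF q])
  with add show ?thesis
    by (intro linearI) simp_all
qed

section \<open>Hahn-Banach by Zorn's lemma\<close>

text \<open>The chain condition serves subadditivity: in \<open>c x + d y\<close> both functionals
  can be replaced by the smaller one, and a single subadditivity then applies. The common bound
  \<open>- p (- x)\<close> keeps the infimum finite.\<close>

lemma sublinear_INF_chain:
  assumes C: "C \<noteq> {}" "\<And>c. c \<in> C \<Longrightarrow> sublinear c" "\<And>c. c \<in> C \<Longrightarrow> c \<le> p"
    and chain: "\<And>c d. c \<in> C \<Longrightarrow> d \<in> C \<Longrightarrow> c \<le> d \<or> d \<le> c"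
  shows "sublinear (\<lambda>x. INF c\<in>C. c x)"
    and "\<And>c. c \<in> C \<Longrightarrow> (\<lambda>x. INF c\<in>C. c x) \<le> c"
proof -
  let ?q = "\<lambda>x. INF c\<in>C. c x"
  have "- p (- x) \<le> c x" if "c \<in> C" for c x
    using sublinear_minus_le[OF C(2)[OF that], of x] le_funD[OF C(3)[OF that], of "- x"] by simp
  then have lower: "?q x \<le> c x" if "c \<in> C" for c x
    using that by (intro cINF_lower bdd_belowI2)
  then show "?q \<le> c" if "c \<in> C" for c
    using that by (simp add: le_fun_def)
  show "sublinear ?q"
    unfolding sublinear_def
  proof (intro conjI allI impI)
    fix x y
    have le: "?q (x + y) \<le> c x + d y" if cd: "c \<in> C" "d \<in> C" for c d
    proof -
      obtain m where m: "m \<in> C" "m \<le> c" "m \<le> d"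
        using chain[OF cd] cd by auto
      have "?q (x + y) \<le> m x + m y"
        using lower[OF m(1), of "x + y"] sublinear_add[OF C(2)[OF m(1)], of x y] by simp
      then show ?thesis
        using le_funD[OF m(2), of x] le_funD[OF m(3), of y] by simp
    qed
    have "?q (x + y) - c x \<le> ?q y" if "c \<in> C" for c
      using le[OF that] by (intro cINF_greatest C(1)) (simp only: diff_le_eq add.commute)
    then have "?q (x + y) - ?q y \<le> ?q x"
      by (intro cINF_greatest C(1)) (simp only: diff_le_eq add.commute)
    then show "?q (x + y) \<le> ?q x + ?q y"
      by simp
  next
    fix r :: real and x
    assume "0 \<le> r"
    show "?q (r *\<^sub>R x) \<le> r * ?q x"
    proof (cases "r = 0")
      case True
      obtain c where c: "c \<in> C" using C(1) by blast
      show ?thesis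
        using True lower[OF c, of 0] sublinear_0[OF C(2)[OF c]] by simp
    next
      case False
      with \<open>0 \<le> r\<close> have "0 < r" by simp
      have "?q (r *\<^sub>R x) / r \<le> c x" if "c \<in> C" for c
        using lower[OF that, of "r *\<^sub>R x"] sublinear_scaleR[OF C(2)[OF that] \<open>0 \<le> r\<close>, of x] \<open>0 < r\<close>
        by (simp add: pos_divide_le_eq mult.commute)
      then have "?q (r *\<^sub>R x) / r \<le> ?q x"
        using C(1) by (intro cINF_greatest)
      then show ?thesis
        using \<open>0 < r\<close> by (simp add: pos_divide_le_eq mult.commute)
    qed
  qed
qed

text \<open>Zorn's lemma in the reversed order gives a minimal sublinear functional below
  \<open>p\<close>, and minimality forces linearity. No subspace is extended step by step.\<close>

lemma hahn_banach_sublinear: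
  assumes p: "sublinear p"
  obtains l where "linear l" "l \<le> p"
proof -
  let ?S = "{q. sublinear q \<and> q \<le> p}"
  have "\<exists>m\<in>?S. \<forall>a\<in>?S. a \<le> m \<longrightarrow> a = m"
  proof (rule predicate_Zorn)
    show "partial_order_on ?S (relation_of (\<lambda>a b. b \<le> a) ?S)"
      by (rule partial_order_on_relation_ofI) auto
  next
    fix C assume C: "C \<in> Chains (relation_of (\<lambda>a b. b \<le> a) ?S)"
    show "\<exists>u\<in>?S. \<forall>a\<in>C. u \<le> a"
    proof (cases "C = {}")
      case True
      then show ?thesis using p by auto
    next
      case False
      have sub: "c \<in> C \<Longrightarrow> sublinear c" "c \<in> C \<Longrightarrow> c \<le> p" for c
        using Chains_relation_of[OF C] by auto
      have chain: "c \<in> C \<Longrightarrow> d \<in> C \<Longrightarrow> c \<le> d \<or> d \<le> c" for c d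
        using C unfolding Chains_def relation_of_def by blast
      note inf = sublinear_INF_chain[OF False sub chain]
      obtain c where "c \<in> C" using False by blast
      with inf(2)[of c] sub(2)[of c] have "(\<lambda>x. INF c\<in>C. c x) \<le> p"
        by (meson order_trans)
      then show ?thesis
        using inf by (intro bexI[of _ "\<lambda>x. INF c\<in>C. c x"]) auto
    qed
  qed
  then obtain m where m: "sublinear m" "m \<le> p"
    and minimal: "\<And>a. sublinear a \<Longrightarrow> a \<le> p \<Longrightarrow> a \<le> m \<Longrightarrow> a = m"
    by auto
  have "linear m"
    using m(2) minimal by (intro minimal_sublinear_is_linear[OF m(1)]) (meson order_trans)
  with m(2) show thesis
    by (intro that)
qed

text \<open>
  A linear functional below \<open>sublinear_shift norm u\<close> is at most \<open>- norm u\<close> at \<open>- u\<close>, hence norming; this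
  avoids extending from the span of \<open>u\<close>.
\<close>

lemma ex_real_norming_functional:
  fixes u :: "'a::real_normed_vector"
  obtains l :: "'a \<Rightarrow> real" where "linear l" "\<And>x. l x \<le> norm x" "l u = norm u"
proof -
  obtain l where l: "linear l" "l \<le> sublinear_shift norm u"
    using hahn_banach_sublinear[OF sublinear_sublinear_shift[OF sublinear_norm]] .
  have le: "l x \<le> norm (x + t *\<^sub>R u) - t * norm u" if "0 \<le> t" for x t
    using le_funD[OF l(2), of x] sublinear_shift_le[OF sublinear_norm that, of u x] by simp
  have "l x \<le> norm x" for x
    using le[of 0 x] by simp
  moreover have "norm u \<le> l u"
    using le[of 1 "- u"] linear_neg[OF l(1), of u] by simp
  ultimately show thesis
    by (intro that[OF l(1)] antisym)
qed

text \<open>A real functional \<open>l\<close> is the real part of the complex-linear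
  \<open>L x = l x - \<i> * l (\<i> *\<^sub>C x)\<close>. Rotating \<open>x\<close> until
  \<open>L x\<close> is real and nonnegative carries the bound on \<open>l\<close> over to
  \<open>L\<close>.\<close>

lemma ex_complex_norming_functional:
  fixes u :: "'a::complex_normed_vector"
  obtains L :: "'a \<Rightarrow> complex"
  where "bounded_linear L" "\<And>c x. L (c *\<^sub>C x) = c * L x" "\<And>x. cmod (L x) \<le> norm x"
    "L u = complex_of_real (norm u)"
proof -
  obtain l :: "'a \<Rightarrow> real" where l: "linear l" "\<And>x. l x \<le> norm x" "l u = norm u"
    using ex_real_norming_functional[of u] by metis
  define L where "L x = Complex (l x) (- l (\<i> *\<^sub>C x))" for x
  have scaleC_scaleR: "c *\<^sub>C r *\<^sub>R x = r *\<^sub>R c *\<^sub>C x" for c r and x :: 'a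
    by (metis mult.commute scaleC_of_real scaleC_scaleC)
  have L_add: "L (x + y) = L x + L y" for x y
    by (simp add: L_def scaleC_add_right linear_add[OF l(1)] complex_eq_iff)
  have L_scaleR: "L (r *\<^sub>R x) = r *\<^sub>R L x" for r x
    by (simp add: L_def scaleC_scaleR linear_scale[OF l(1)] complex_eq_iff)
  have L_ii: "L (\<i> *\<^sub>C x) = \<i> * L x" for x
  proof -
    have "\<i> *\<^sub>C \<i> *\<^sub>C x = - x"
      using scaleC_of_real[of "-1" x] by (simp add: scaleC_scaleC)
    then show ?thesis
      by (simp add: L_def linear_neg[OF l(1)] complex_eq_iff)
  qed
  have L_scaleC: "L (c *\<^sub>C x) = c * L x" for c x
  proof -
    have "c *\<^sub>C x = Re c *\<^sub>R x + Im c *\<^sub>R \<i> *\<^sub>C x"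
      by (metis complex_eq mult.commute scaleC_add_left scaleC_of_real scaleC_scaleC)
    then have "L (c *\<^sub>C x) = (of_real (Re c) + \<i> * of_real (Im c)) * L x"
      by (simp add: L_add L_scaleR L_ii scaleR_conv_of_real algebra_simps)
    then show ?thesis
      by (simp flip: complex_eq)
  qed
  have L_norm: "cmod (L x) \<le> norm x" for x
  proof -
    \<comment> \<open>The rotation turning \<open>L x\<close> into its modulus. Since
      \<open>sgn 0 = 0\<close>, the modulus of \<open>?c\<close> is 0 or 1, so it never increases a
      norm.\<close>
    let ?c = "cnj (sgn (L x))"
    have "?c * L x = complex_of_real (cmod (L x))"
    proof (cases "L x = 0")
      case False
      have "cnj (L x) * L x = complex_of_real (cmod (L x)) * complex_of_real (cmod (L x))"
        by (metis complex_norm_square mult.commute power2_eq_square of_real_mult)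
      with False show ?thesis
        by (simp add: sgn_eq)
    qed simp
    then have "cmod (L x) = Re (L (?c *\<^sub>C x))"
      by (simp add: L_scaleC)
    also have "\<dots> \<le> norm (?c *\<^sub>C x)"
      by (simp add: L_def l(2))
    also have "\<dots> \<le> norm x"
      by (simp add: norm_scaleC norm_sgn)
    finally show ?thesis .
  qed
  have "bounded_linear L"
    by (rule bounded_linear_intro[of L 1]) (auto simp: L_add L_scaleR L_norm)
  moreover have "L u = complex_of_real (norm u)"
  proof -
    \<comment> \<open>The real part already exhausts the bound on the modulus, which leaves no room
      for an imaginary part.\<close>
    have Re: "Re (L u) = norm u"
      by (simp add: L_def l(3))
    moreover have "(Re (L u))\<^sup>2 + (Im (L u))\<^sup>2 \<le> (norm u)\<^sup>2"
      using power_mono[OF L_norm[of u], of 2] by (simp flip: cmod_power2)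
    then have "Im (L u) = 0"
      by (simp add: Re)
    ultimately show ?thesis
      by (simp add: complex_eq_iff)
  qed
  ultimately show thesis
    using L_scaleC L_norm by (intro that)
qed

section \<open>Test functions from disc automorphisms\<close>

text \<open>For \<open>\<bar>r\<bar> < 1\<close>, the Moebius automorphism of the unit disc taking
  \<open>r\<close> to 0. The parameter is real because it will be the norm of a point.\<close>

definition disc_aut :: "real \<Rightarrow> complex \<Rightarrow> complex"
  where "disc_aut r z = (z - of_real r) / (1 - of_real r * z)"

lemma disc_aut_denominator_nonzero:
  assumes "\<bar>r\<bar> < 1" "cmod z \<le> 1"
  shows "1 - of_real r * z \<noteq> 0"
proof
  assume "1 - of_real r * z = 0"
  then have "\<bar>r\<bar> * cmod z = 1"
    by (metis eq_iff_diff_eq_0 norm_mult norm_of_real norm_one)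
  moreover have "\<bar>r\<bar> * cmod z \<le> \<bar>r\<bar> * 1"
    using assms(2) by (intro mult_left_mono) auto
  ultimately show False
    using assms(1) by simp
qed

text \<open>For \<open>\<bar>r\<bar> < 1\<close> the right side has the sign of
  \<open>1 - (cmod z)\<^sup>2\<close>, which decides whether \<open>disc_aut r\<close> keeps the
  closed and the open disc inside themselves.\<close>

lemma disc_aut_norm_identity:
  "(cmod (1 - of_real r * z))\<^sup>2 - (cmod (z - of_real r))\<^sup>2 = (1 - r\<^sup>2) * (1 - (cmod z)\<^sup>2)"
  unfolding cmod_power2 by (simp add: power2_eq_square algebra_simps)

lemma norm_disc_aut_le_1:
  assumes r: "\<bar>r\<bar> < 1" and z: "cmod z \<le> 1"
  shows "cmod (disc_aut r z) \<le> 1"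
proof -
  have "0 \<le> (1 - r\<^sup>2) * (1 - (cmod z)\<^sup>2)"
    using r z by (intro mult_nonneg_nonneg) (simp_all add: abs_square_le_1 power_le_one)
  then have "(cmod (z - of_real r))\<^sup>2 \<le> (cmod (1 - of_real r * z))\<^sup>2"
    using disc_aut_norm_identity[of r z] by linarith
  then have "cmod (z - of_real r) \<le> cmod (1 - of_real r * z)"
    by (rule power2_le_imp_le) simp
  then show ?thesis
    by (simp add: disc_aut_def norm_divide divide_le_eq_1)
qed

lemma norm_disc_aut_less_1:
  assumes r: "\<bar>r\<bar> < 1" and z: "cmod z < 1"
  shows "cmod (disc_aut r z) < 1"
proof -
  have "0 < (1 - r\<^sup>2) * (1 - (cmod z)\<^sup>2)"
    using r z by (intro mult_pos_pos) (simp_all add: abs_square_less_1)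
  then have "(cmod (z - of_real r))\<^sup>2 < (cmod (1 - of_real r * z))\<^sup>2"
    using disc_aut_norm_identity[of r z] by linarith
  then have "cmod (z - of_real r) < cmod (1 - of_real r * z)"
    by (rule power2_less_imp_less) simp
  then show ?thesis
    using disc_aut_denominator_nonzero[OF r, of z] z by (simp add: disc_aut_def norm_divide)
qed

lemma disc_aut_inverse:
  assumes "\<bar>r\<bar> < 1" "cmod z \<le> 1"
  shows "disc_aut r (disc_aut (- r) z) = z"
proof -
  let ?r = "complex_of_real r"
  have nz: "1 + ?r * z \<noteq> 0"
    using disc_aut_denominator_nonzero[of "- r" z] assms by simp
  \<comment> \<open>The denominator at the point \<open>z = r\<close>.\<close>
  have "1 - ?r * ?r \<noteq> 0"
    using disc_aut_denominator_nonzero[of r ?r] assms(1) by simp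
  moreover have "disc_aut (- r) z - ?r = z * (1 - ?r * ?r) / (1 + ?r * z)"
    using nz by (simp add: disc_aut_def field_simps)
  moreover have "1 - ?r * disc_aut (- r) z = (1 - ?r * ?r) / (1 + ?r * z)"
    using nz by (simp add: disc_aut_def field_simps)
  ultimately show ?thesis
    using nz by (simp add: disc_aut_def[of r])
qed

lemma holomorphic_disc_aut:
  assumes "\<bar>r\<bar> < 1"
  shows "disc_aut r holomorphic_on ball 0 1"
  unfolding disc_aut_def using disc_aut_denominator_nonzero[OF assms]
  by (intro holomorphic_intros) auto

lemma disc_aut_has_field_derivative:
  assumes "\<bar>r\<bar> < 1" "cmod z \<le> 1"
  obtains D where "(disc_aut r has_field_derivative D) (at z)"
proof -
  have "disc_aut r field_differentiable at z"
    unfolding disc_aut_def using disc_aut_denominator_nonzero[OF assms]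
    by (intro derivative_intros) auto
  then show thesis
    using that by (auto simp: field_differentiable_def)
qed

section \<open>Slices by complex lines and the test function\<close>

lemma has_derivative_scaleC_left:
  "((\<lambda>z. z *\<^sub>C u) has_derivative (\<lambda>z. z *\<^sub>C (u::'a::complex_normed_vector))) F"
proof (rule bounded_linear_imp_has_derivative)
  show "bounded_linear (\<lambda>z. z *\<^sub>C u)"
  proof (rule bounded_linear_intro[of _ "norm u"])
    show "(r *\<^sub>R z) *\<^sub>C u = r *\<^sub>R z *\<^sub>C u" for r z
      by (metis scaleC_of_real scaleC_scaleC scaleR_conv_of_real)
  qed (simp_all add: scaleC_add_left norm_scaleC)
qed

lemma ball_subset_interior_cball: "ball (0::'a::real_normed_vector) 1 \<subseteq> interior (cball 0 1)"
  by (intro interior_maximal) auto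

text \<open>By the chain rule the slice has derivative \<open>\<lambda>c. D (c *\<^sub>C u)\<close>;
  complex homogeneity of \<open>D\<close> makes this multiplication by \<open>D u\<close>, hence a
  complex derivative. One-variable theory thus applies to \<open>f\<close>.\<close>

lemma holomorphic_on_slice:
  fixes u :: "'a::complex_banach"
  assumes f: "f \<in> A_b" and u: "norm u = 1"
  shows "(\<lambda>z. apply_bcontfun f (to_unit_ball (z *\<^sub>C u))) holomorphic_on ball 0 1"
proof (rule holomorphic_onI)
  fix z :: complex assume "z \<in> ball 0 1"
  then have "z *\<^sub>C u \<in> interior (cball 0 1)"
    using ball_subset_interior_cball[where 'a='a] u by (auto simp: norm_scaleC)
  then obtain D where D:
    "((\<lambda>x. apply_bcontfun f (to_unit_ball x)) has_derivative D) (at (z *\<^sub>C u))"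
    "\<And>c v. D (c *\<^sub>C v) = c * D v"
    using f by (auto simp: A_b_def holomorphic_on_open_def)
  have "((\<lambda>z. apply_bcontfun f (to_unit_ball (z *\<^sub>C u))) has_derivative (\<lambda>c. D (c *\<^sub>C u))) (at z)"
    by (rule has_derivative_compose[OF has_derivative_scaleC_left D(1)])
  then have "((\<lambda>z. apply_bcontfun f (to_unit_ball (z *\<^sub>C u))) has_field_derivative D u) (at z)"
    by (simp add: has_field_derivative_def D(2) mult.commute[of _ "D u"])
  then show "(\<lambda>z. apply_bcontfun f (to_unit_ball (z *\<^sub>C u))) field_differentiable at z within ball 0 1"
    using field_differentiable_at_within field_differentiable_def by blast
qed

text \<open>Maximum modulus principle, with \<open>w\<close> a maximiser on the compact circle. The
  bound \<open>\<rho> < 1\<close> keeps the closed disc where \<open>F\<close> is known to be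
  continuous.\<close>

lemma ex_point_on_circle_ge:
  assumes hol: "F holomorphic_on ball 0 1" and \<rho>: "0 < \<rho>" "\<rho> < 1"
  obtains w where "cmod w = \<rho>" "cmod (F 0) \<le> cmod (F w)"
proof -
  have cont: "continuous_on (cball 0 \<rho>) F"
    using \<rho> by (intro holomorphic_on_imp_continuous_on holomorphic_on_subset[OF hol]) auto
  have "sphere (0::complex) \<rho> \<noteq> {}"
    using \<rho> by simp
  then obtain w where w: "w \<in> sphere 0 \<rho>" "\<And>z. z \<in> sphere 0 \<rho> \<Longrightarrow> cmod (F z) \<le> cmod (F w)"
    using continuous_attains_sup[of "sphere 0 \<rho>" "\<lambda>z. cmod (F z)"]
    by (metis compact_sphere cont continuous_on_norm continuous_on_subset sphere_cball)
  have "cmod (F 0) \<le> cmod (F w)"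
  proof (rule maximum_modulus_frontier[where f = F and S = "cball 0 \<rho>" and \<xi> = 0])
    show "F holomorphic_on interior (cball 0 \<rho>)"
      using \<rho> by (intro holomorphic_on_subset[OF hol]) auto
    show "continuous_on (closure (cball 0 \<rho>)) F"
      using cont by simp
    show "cmod (F z) \<le> cmod (F w)" if "z \<in> frontier (cball 0 \<rho>)" for z
      using that \<rho> w(2) by (simp add: frontier_cball)
  qed (use \<rho> in auto)
  with w(1) show thesis
    by (intro that) auto
qed

text \<open>Take \<open>\<theta> * disc_aut r (L x)\<close> with \<open>L\<close> norming
  \<open>u\<close>. Since \<open>L (z *\<^sub>C u) = z\<close>, on the disc spanned by
  \<open>u\<close> this is the rotated automorphism, which gives both prescribed values.\<close>

lemma ex_test_function:
  fixes u :: "'a::complex_banach"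
  assumes u: "norm u = 1" and r: "\<bar>r\<bar> < 1" and w: "cmod w < 1" and \<theta>: "cmod \<theta> = 1"
  obtains g :: "'a unit_ball \<Rightarrow>\<^sub>C complex" where "g \<in> A_u" "norm g = 1"
    "apply_bcontfun g (to_unit_ball (r *\<^sub>R u)) = 0"
    "apply_bcontfun g (to_unit_ball (disc_aut (- r) w *\<^sub>C u)) = \<theta> * w"
proof -
  obtain L :: "'a \<Rightarrow> complex" where L: "bounded_linear L" "\<And>c x. L (c *\<^sub>C x) = c * L x"
    "\<And>x. cmod (L x) \<le> norm x" "L u = complex_of_real (norm u)"
    using ex_complex_norming_functional[of u] by metis
  define G where "G x = \<theta> * disc_aut r (L (of_unit_ball x))" for x
  have ball: "norm (of_unit_ball x) \<le> 1" for x :: "'a unit_ball"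
    using of_unit_ball[of x] by simp
  have L_ball: "cmod (L (of_unit_ball x)) \<le> 1" for x
    using L(3)[of "of_unit_ball x"] ball[of x] by linarith
  have L_uc: "uniformly_continuous_on UNIV (\<lambda>x. L (of_unit_ball x))"
    unfolding uniformly_continuous_on_def
  proof (intro allI impI)
    fix e :: real assume "0 < e"
    have "dist (L (of_unit_ball x')) (L (of_unit_ball x)) \<le> dist x' x" for x x' :: "'a unit_ball"
      using L(3)[of "of_unit_ball x' - of_unit_ball x"]
      by (simp add: dist_unit_ball_def dist_norm linear_diff[OF bounded_linear.linear[OF L(1)]])
    with \<open>0 < e\<close> show "\<exists>d>0. \<forall>x\<in>UNIV. \<forall>x'\<in>UNIV. dist x' x < d \<longrightarrow>
        dist (L (of_unit_ball x')) (L (of_unit_ball x)) < e"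
      by (meson le_less_trans)
  qed
  \<comment> \<open>Uniform continuity comes from compactness of the closed complex disc, into which
    \<open>L\<close> maps the ball of \<open>X\<close>.\<close>
  have "continuous_on (cball 0 1) (\<lambda>z. \<theta> * disc_aut r z)"
    unfolding disc_aut_def using disc_aut_denominator_nonzero[OF r]
    by (intro continuous_intros) auto
  then have "uniformly_continuous_on (cball 0 1) (\<lambda>z. \<theta> * disc_aut r z)"
    by (rule compact_uniformly_continuous) simp
  then have "uniformly_continuous_on (range (\<lambda>x. L (of_unit_ball x))) (\<lambda>z. \<theta> * disc_aut r z)"
    unfolding uniformly_continuous_on_def using L_ball
    by (metis (no_types, lifting) imageE mem_cball_0)
  then have G_uc: "uniformly_continuous_on UNIV G"
    using uniformly_continuous_on_compose[OF L_uc] unfolding G_def by blast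
  have G_le: "cmod (G x) \<le> 1" for x
    using norm_disc_aut_le_1[OF r L_ball] \<theta> by (simp add: G_def norm_mult)
  have "G \<in> bcontfun"
    using G_uc G_le by (intro bcontfun_normI uniformly_continuous_imp_continuous)
  then obtain g where g: "G = apply_bcontfun g"
    by (rule bcontfunE)
  have g_app: "apply_bcontfun g (to_unit_ball x) = \<theta> * disc_aut r (L x)" if "norm x \<le> 1" for x
    using that by (simp flip: g add: G_def to_unit_ball_inverse)
  have "g \<in> A_b"
    unfolding A_b_def holomorphic_on_open_def mem_Collect_eq
  proof (intro conjI ballI)
    fix x :: 'a assume x: "x \<in> interior (cball 0 1)"
    then have "norm x \<le> 1"
      using interior_subset by fastforce
    then have "cmod (L x) \<le> 1"
      using L(3)[of x] by linarith
    then obtain D where D: "(disc_aut r has_field_derivative D) (at (L x))"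
      using disc_aut_has_field_derivative[OF r] by blast
    have "((\<lambda>x. \<theta> * disc_aut r (L x)) has_derivative (\<lambda>v. \<theta> * (D * L v))) (at x)"
      using has_derivative_compose[OF bounded_linear_imp_has_derivative[OF L(1)]
          D[unfolded has_field_derivative_def]]
      by (rule has_derivative_mult_right)
    \<comment> \<open>The formula for \<open>g\<close> is available only on the closed ball, so the
      derivative is transferred on its interior.\<close>
    then have "((\<lambda>x. apply_bcontfun g (to_unit_ball x)) has_derivative (\<lambda>v. \<theta> * (D * L v))) (at x)"
      by (rule has_derivative_transform_within_open[OF _ open_interior x])
        (use interior_subset g_app in fastforce)
    then show "\<exists>D. ((\<lambda>x. apply_bcontfun g (to_unit_ball x)) has_derivative D) (at x) \<and>
        (\<forall>c v. D (c *\<^sub>C v) = c * D v)"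
      by (intro exI[of _ "\<lambda>v. \<theta> * (D * L v)"]) (simp add: L(2))
  qed simp
  then have "g \<in> A_u"
    using G_uc by (simp add: A_u_def g)
  moreover have "norm g = 1"
  proof (rule antisym)
    show "norm g \<le> 1"
      using G_le by (intro norm_bound) (simp flip: g)
    \<comment> \<open>The norm is attained at \<open>u\<close>, because \<open>L u = 1\<close> is a
      fixed point of the automorphism.\<close>
    have "disc_aut r 1 = 1"
      using disc_aut_denominator_nonzero[OF r, of 1] by (simp add: disc_aut_def)
    then have "cmod (apply_bcontfun g (to_unit_ball u)) = 1"
      using u \<theta> by (simp add: g_app L(4))
    then show "1 \<le> norm g"
      using norm_bounded[of g "to_unit_ball u"] by simp
  qed
  moreover have "apply_bcontfun g (to_unit_ball (r *\<^sub>R u)) = 0"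
    using g_app[of "complex_of_real r *\<^sub>C u"] u r
    by (simp add: norm_scaleC L(2,4) disc_aut_def) (simp add: scaleC_of_real)
  moreover have "apply_bcontfun g (to_unit_ball (disc_aut (- r) w *\<^sub>C u)) = \<theta> * w"
    using norm_disc_aut_less_1[of "- r" w] r w u
    by (simp add: g_app norm_scaleC L(2,4) disc_aut_inverse)
  ultimately show thesis
    by (rule that)
qed

section \<open>Nowhere differentiability\<close>

text \<open>A near-maximiser may lie on the sphere; continuity of \<open>f\<close> allows it to be
  pulled radially inwards.\<close>

lemma ex_interior_point_near_norm:
  fixes f :: "'a::complex_banach unit_ball \<Rightarrow>\<^sub>C complex"
  assumes "0 < \<eta>"
  obtains x :: 'a where "norm x < 1" "norm f - \<eta> < cmod (apply_bcontfun f (to_unit_ball x))"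
proof -
  have "\<exists>b. norm f - \<eta> < cmod (apply_bcontfun f b)"
  proof (rule ccontr)
    assume "\<not> ?thesis"
    then have "norm f \<le> norm f - \<eta>"
      by (intro norm_bound) (simp add: not_less)
    with assms show False by simp
  qed
  then obtain b where b: "norm f - \<eta> < cmod (apply_bcontfun f b)" ..
  \<comment> \<open>The factors start at 0, stay below 1 and tend to 1.\<close>
  define x where "x n = (1 - inverse (real (Suc n))) *\<^sub>R of_unit_ball b" for n
  have b1: "norm (of_unit_ball b) \<le> 1"
    using of_unit_ball[of b] by simp
  have x_less: "norm (x n) < 1" for n
  proof -
    have "norm (x n) \<le> \<bar>1 - inverse (real (Suc n))\<bar> * 1"
      using b1 by (simp only: x_def norm_scaleR) (intro mult_left_mono, auto)
    also have "\<dots> < 1"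
      by (simp add: field_simps)
    finally show ?thesis .
  qed
  have "x \<longlonglongrightarrow> (1 - 0) *\<^sub>R of_unit_ball b"
    unfolding x_def by (intro tendsto_intros LIMSEQ_inverse_real_of_nat)
  moreover have "of_unit_ball (to_unit_ball (x n)) = x n" for n
    using less_imp_le[OF x_less] by (simp add: to_unit_ball_inverse)
  ultimately have "(\<lambda>n. to_unit_ball (x n)) \<longlonglongrightarrow> b"
    unfolding tendsto_dist_iff[of _ b] tendsto_dist_iff[of x] dist_unit_ball_def by simp
  then have "(\<lambda>n. apply_bcontfun f (to_unit_ball (x n))) \<longlonglongrightarrow> apply_bcontfun f b"
    by (rule continuous_on_tendsto_compose[OF continuous_on_apply_bcontfun[of UNIV]]) auto
  then have "(\<lambda>n. cmod (apply_bcontfun f (to_unit_ball (x n)))) \<longlonglongrightarrow> cmod (apply_bcontfun f b)"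
    by (rule tendsto_norm)
  then have "\<forall>\<^sub>F n in sequentially. norm f - \<eta> < cmod (apply_bcontfun f (to_unit_ball (x n)))"
    using b by (rule order_tendstoD(1))
  then obtain n where "norm f - \<eta> < cmod (apply_bcontfun f (to_unit_ball (x n)))"
    by (auto simp: eventually_sequentially)
  with x_less show thesis
    by (rule that)
qed

text \<open>At \<open>x = 0\<close> any unit vector serves, and nontriviality provides one.\<close>

lemma ex_unit_direction:
  fixes x :: "'a::real_normed_vector"
  assumes "\<exists>v::'a. v \<noteq> 0"
  obtains u where "norm u = 1" "x = norm x *\<^sub>R u"
proof (cases "x = 0")
  case True
  obtain v :: 'a where "v \<noteq> 0" using assms ..
  then show thesis using that[of "sgn v"] True by (simp add: norm_sgn)
next
  case False
  then show thesis using that[of "sgn x"] by (simp add: norm_sgn sgn_div_norm)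
qed

text \<open>The direction \<open>g\<close> may depend on \<open>t\<close>, so what fails is
  uniformity over the sphere. Evaluation at two points gains \<open>t / 2\<close> and loses
  \<open>t / 8\<close> twice, leaving \<open>t / 4\<close>.\<close>

lemma ex_direction_of_large_second_difference:
  fixes f :: "'a::complex_banach unit_ball \<Rightarrow>\<^sub>C complex"
  assumes nontrivial: "\<exists>v::'a. v \<noteq> 0" and f: "f \<in> A_b" and t: "0 < t"
  obtains g where "g \<in> A_u" "norm g = 1"
    "2 * norm f + t / 4 < norm (f + t *\<^sub>R g) + norm (f - t *\<^sub>R g)"
proof -
  obtain x :: 'a where x: "norm x < 1" "norm f - t / 8 < cmod (apply_bcontfun f (to_unit_ball x))"
    using ex_interior_point_near_norm[of "t / 8" f] t by auto
  obtain u where u: "norm u = 1" "x = norm x *\<^sub>R u"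
    using ex_unit_direction[OF nontrivial] .
  define r where "r = norm x"
  have r: "\<bar>r\<bar> < 1" "\<bar>- r\<bar> < 1" and xr: "x = r *\<^sub>R u"
    using x(1) u(2) by (simp_all add: r_def)
  \<comment> \<open>Here \<open>w\<close> is a disc coordinate centred at \<open>x\<close>:
    \<open>disc_aut (- r) 0 = r\<close>, so \<open>y 0\<close> is the point
    \<open>x\<close>.\<close>
  define y where "y w = to_unit_ball (disc_aut (- r) w *\<^sub>C u)" for w
  have "disc_aut (- r) ` ball 0 1 \<subseteq> ball 0 1"
    using norm_disc_aut_less_1[OF r(2)] by auto
  then have "(\<lambda>w. apply_bcontfun f (y w)) holomorphic_on ball 0 1"
    using holomorphic_on_compose_gen[OF holomorphic_disc_aut[OF r(2)] holomorphic_on_slice[OF f u(1)]]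
    by (simp add: y_def o_def)
  then obtain w where w: "cmod w = 1 / 2"
      "cmod (apply_bcontfun f (y 0)) \<le> cmod (apply_bcontfun f (y w))"
    by (rule ex_point_on_circle_ge[where \<rho> = "1 / 2"]) simp_all
  have "y 0 = to_unit_ball x"
    by (simp add: y_def xr disc_aut_def scaleC_of_real)
  with w x(2) have fy: "norm f - t / 8 < cmod (apply_bcontfun f (y w))"
    by simp
  define a where "a = apply_bcontfun f (y w)"
  \<comment> \<open>The phase of \<open>a\<close>, taken as 1 when \<open>a = 0\<close> because
    \<open>sgn 0\<close> is not unimodular.\<close>
  obtain \<sigma> where \<sigma>: "cmod \<sigma> = 1" "a = \<sigma> * of_real (cmod a)"
  proof (cases "a = 0")
    case True
    then show thesis using that[of 1] by simp
  next
    case False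
    then show thesis by (intro that[of "sgn a"]) (simp add: norm_sgn, simp add: sgn_eq)
  qed
  \<comment> \<open>Makes \<open>\<theta> * w\<close> a nonnegative multiple of
    \<open>\<sigma>\<close>, so that the moduli of \<open>a\<close> and
    \<open>t *\<^sub>R (\<theta> * w)\<close> add up.\<close>
  define \<theta> where "\<theta> = \<sigma> / sgn w"
  have "w \<noteq> 0" using w(1) by auto
  then have \<theta>: "cmod \<theta> = 1"
    by (simp add: \<theta>_def norm_divide norm_sgn \<sigma>(1))
  obtain g :: "'a unit_ball \<Rightarrow>\<^sub>C complex" where g: "g \<in> A_u" "norm g = 1"
    "apply_bcontfun g (to_unit_ball x) = 0" "apply_bcontfun g (y w) = \<theta> * w"
    using ex_test_function[OF u(1) r(1) _ \<theta>, of w] w(1) unfolding y_def xr by auto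
  have aligned: "cmod (a + t *\<^sub>R (\<theta> * w)) = cmod a + t / 2"
  proof -
    have "\<theta> * w = \<sigma> * of_real (cmod w)"
      using \<open>w \<noteq> 0\<close> by (simp add: \<theta>_def sgn_eq)
    then have "t *\<^sub>R (\<theta> * w) = \<sigma> * of_real (t / 2)"
      by (simp add: w(1) scaleR_conv_of_real mult.assoc)
    then have "a + t *\<^sub>R (\<theta> * w) = \<sigma> * of_real (cmod a) + \<sigma> * of_real (t / 2)"
      by (rule arg_cong2[where f = plus, OF \<sigma>(2)])
    also have "\<dots> = \<sigma> * of_real (cmod a + t / 2)"
      by (simp only: of_real_add distrib_left)
    finally show ?thesis
      using t by (simp only: norm_mult norm_of_real \<sigma>(1)) simp
  qed
  have "norm f - t / 8 + t / 2 < norm (f + t *\<^sub>R g)"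
    using norm_bounded[of "f + t *\<^sub>R g" "y w"] fy aligned by (simp add: g(4) a_def)
  moreover have "norm f - t / 8 < norm (f - t *\<^sub>R g)"
    using norm_bounded[of "f - t *\<^sub>R g" "to_unit_ball x"] x(2) by (simp add: g(3))
  ultimately show thesis
    using g(1,2) by (intro that) auto
qed

theorem theorem2p9:
  fixes A :: "('a :: complex_banach unit_ball \<Rightarrow>\<^sub>C complex) set"
  assumes nontrivial: "\<exists>x :: 'a. x \<noteq> 0"
    and A: "A = A_u \<or> A = A_b"
  shows "\<forall>f\<in>A. \<not> norm_frechet_differentiable_at A f"
proof (intro ballI notI)
  fix f assume f: "f \<in> A" and diff: "norm_frechet_differentiable_at A f"
  \<comment> \<open>Treats both algebras at once: the test function lies in the smaller one, while
    \<open>f\<close> is only used as a member of the larger one.\<close>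
  have sub: "A_u \<subseteq> A" "A \<subseteq> A_b"
    using A by (auto simp: A_u_def)
  let ?Q = "\<lambda>t y. (norm (f + t *\<^sub>R y) + norm (f - t *\<^sub>R y) - 2 * norm f) / t"
  \<comment> \<open>The tolerance \<open>1 / 4\<close> is exactly what the gain \<open>t / 4\<close>
    exceeds after division by \<open>t\<close>.\<close>
  have "\<forall>\<^sub>F t in at (0::real). \<forall>y\<in>{y \<in> A. norm y = 1}. dist (?Q t y) 0 < 1 / 4"
    using diff unfolding norm_frechet_differentiable_at_def
    by (rule uniform_limitD) simp
  then obtain d where d: "0 < d"
      "\<And>t y. t \<noteq> 0 \<Longrightarrow> dist t 0 < d \<Longrightarrow> y \<in> A \<Longrightarrow> norm y = 1 \<Longrightarrow> dist (?Q t y) 0 < 1 / 4"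
    unfolding eventually_at by blast
  define t where "t = d / 2"
  have t: "0 < t" using d(1) by (simp add: t_def)
  obtain g where g: "g \<in> A_u" "norm g = 1"
    "2 * norm f + t / 4 < norm (f + t *\<^sub>R g) + norm (f - t *\<^sub>R g)"
    using ex_direction_of_large_second_difference[OF nontrivial _ t] f sub(2) by blast
  have "dist (?Q t g) 0 < 1 / 4"
    using d g(1,2) sub(1) by (intro d(2)) (auto simp: t_def)
  then have "?Q t g < 1 / 4"
    unfolding dist_real_def diff_0_right by (rule le_less_trans[OF abs_ge_self])
  with g(3) t show False
    by (simp add: field_simps)
qed

end
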